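(* Let $1\to N\to G\xrightarrow{\ \pi\ }Q\to1$ be an exact sequence of groups, split by a homomorphism $s:Q\to G$ with $\pi s=\mathrm{id}_Q$. Then there is a split exact sequence $$0\longrightarrow \frac{K(G,N)}{D_s(G,N)}\longrightarrow B_0(G)\xrightarrow{\ B_0(\pi)\ }B_0(Q)\longrightarrow0,$$ where the splitting is induced by $s$.
   Context: For a group $G$, if $x,y\in G$ commute, let $\tau_G(x,y)\in H_2(G,\mathbb Z)$ be the class represented in the normalized bar complex by $[x\mid y]-[y\mid x]$ (the image of the fundamental class of the torus under the map $S^1\times S^1\to BG$ induced by $\mathbb Z^2\to G$). Put $M(G)=H_2(G,\mathbb Z)$, $M_0(G)=\langle\tau_G(x,y)\mid x,y\in G,\ [x,y]=1\rangle$, and $B_0(G)=M(G)/M_0(G)$ (the Bogomolov multiplier); these constructions are functorial. In the setting of the claim, $K(G,N)=\ker\bigl(H_2(\pi):H_2(G,\mathbb Z)\to H_2(Q,\mathbb Z)\bigr)$. For commuting $x,y\in G$ put $\delta_s(x,y)=\tau_G(x,y)-H_2(s)\tau_Q(\pi(x),\pi(y))\in K(G,N)$, and let $D_s(G,N)=\langle\delta_s(x,y)\mid x,y\in G,\ [x,y]=1\rangle\le K(G,N)$. *)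

theory Defs
  imports "HOL-Algebra.Free_Abelian_Groups" "HOL-Algebra.Exact_Sequence"
begin

section \<open>Split short exact sequences\<close>

text \<open>The library's \<open>short_exact_sequence\<close> forces all groups to live on one type, so the
  characterisation in \<open>short_exact_sequence_iff\<close> is restated here for three different types.
  The sequence is \<open>1 \<rightarrow> A \<rightarrow> B \<rightarrow> C \<rightarrow> 1\<close> with maps \<open>f\<close> and \<open>g\<close>; \<open>t\<close> is a section of \<open>g\<close>.\<close>

definition short_exact ::
  "('a, 'i) monoid_scheme \<Rightarrow> ('a \<Rightarrow> 'b) \<Rightarrow> ('b, 'j) monoid_scheme \<Rightarrow> ('b \<Rightarrow> 'c) \<Rightarrow> ('c, 'k) monoid_scheme \<Rightarrow> bool"
  where "short_exact A f B g C \<longleftrightarrow>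
    group A \<and> group B \<and> group C \<and> f \<in> mon A B \<and> g \<in> epi B C \<and> f ` carrier A = kernel B C g"

definition split_short_exact ::
  "('a, 'i) monoid_scheme \<Rightarrow> ('a \<Rightarrow> 'b) \<Rightarrow> ('b, 'j) monoid_scheme \<Rightarrow> ('b \<Rightarrow> 'c) \<Rightarrow> ('c, 'k) monoid_scheme
    \<Rightarrow> ('c \<Rightarrow> 'b) \<Rightarrow> bool"
  where "split_short_exact A f B g C t \<longleftrightarrow>
    short_exact A f B g C \<and> t \<in> hom C B \<and> (\<forall>c\<in>carrier C. g (t c) = c)"

text \<open>The map \<open>G / L \<rightarrow> H / N\<close> induced by \<open>f\<close>, on cosets: if \<open>f\<close> is a homomorphism with
  \<open>f ` L \<subseteq> N\<close>, all cosets in the union coincide, so that \<open>L #> a\<close> is sent to \<open>N #> f a\<close>.\<close>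

definition quot_induced :: "('b, 'j) monoid_scheme \<Rightarrow> 'b set \<Rightarrow> ('a \<Rightarrow> 'b) \<Rightarrow> 'a set \<Rightarrow> 'b set"
  where "quot_induced H N f C = (\<Union>c\<in>C. N #>\<^bsub>H\<^esub> f c)"


section \<open>Integral group homology via the normalized bar complex\<close>

type_synonym 'a bar_chain = "'a list \<Rightarrow>\<^sub>0 int"

text \<open>The normalized bar complex with the functor of coinvariants applied (trivial coefficients
  \<open>\<int>\<close>): degree \<open>n\<close> is free abelian on the symbols \<open>[g\<^sub>1|\<dots>|g\<^sub>n]\<close> with all \<open>g\<^sub>i \<noteq> 1\<close>, and a
  symbol with some entry \<open>1\<close> denotes \<open>0\<close>.\<close>

definition bar_chain_group :: "('a, 'i) monoid_scheme \<Rightarrow> nat \<Rightarrow> 'a bar_chain monoid"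
  where "bar_chain_group G n =
    free_Abelian_group {xs. length xs = n \<and> set xs \<subseteq> carrier G - {\<one>\<^bsub>G\<^esub>}}"

definition bar_symbol :: "('a, 'i) monoid_scheme \<Rightarrow> 'a list \<Rightarrow> 'a bar_chain"
  where "bar_symbol G xs = (if \<one>\<^bsub>G\<^esub> \<in> set xs then 0 else frag_of xs)"

definition bar_face :: "('a, 'i) monoid_scheme \<Rightarrow> nat \<Rightarrow> 'a list \<Rightarrow> 'a list"
  where "bar_face G i xs =
    (if i = 0 then tl xs
     else if i = length xs then butlast xs
     else take (i - 1) xs @ (xs ! (i - 1) \<otimes>\<^bsub>G\<^esub> xs ! i) # drop (i + 1) xs)"

definition bar_boundary :: "('a, 'i) monoid_scheme \<Rightarrow> nat \<Rightarrow> 'a bar_chain \<Rightarrow> 'a bar_chain"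
  where "bar_boundary G n =
    (if n = 0 then (\<lambda>_. 0)
     else frag_extend (\<lambda>xs. \<Sum>i\<le>n. frag_cmul ((-1) ^ i) (bar_symbol G (bar_face G i xs))))"

text \<open>For \<open>n = 0\<close> the truncated \<open>n - 1\<close> is harmless, as \<open>bar_boundary G 0\<close> is zero.\<close>

definition bar_cycle_group :: "('a, 'i) monoid_scheme \<Rightarrow> nat \<Rightarrow> 'a bar_chain monoid"
  where "bar_cycle_group G n =
    subgroup_generated (bar_chain_group G n)
      (kernel (bar_chain_group G n) (bar_chain_group G (n - 1)) (bar_boundary G n))"

definition bar_boundaries :: "('a, 'i) monoid_scheme \<Rightarrow> nat \<Rightarrow> 'a bar_chain set"
  where "bar_boundaries G n = bar_boundary G (Suc n) ` carrier (bar_chain_group G (Suc n))"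

definition group_homology :: "nat \<Rightarrow> ('a, 'i) monoid_scheme \<Rightarrow> 'a bar_chain set monoid"
  where "group_homology n G = bar_cycle_group G n Mod bar_boundaries G n"

definition bar_map :: "('b, 'j) monoid_scheme \<Rightarrow> ('a \<Rightarrow> 'b) \<Rightarrow> 'a bar_chain \<Rightarrow> 'b bar_chain"
  where "bar_map H f = frag_extend (\<lambda>xs. bar_symbol H (map f xs))"

definition group_homology_map ::
  "nat \<Rightarrow> ('b, 'j) monoid_scheme \<Rightarrow> ('a \<Rightarrow> 'b) \<Rightarrow> 'a bar_chain set \<Rightarrow> 'b bar_chain set"
  where "group_homology_map n H f =
    quot_induced (bar_cycle_group H n) (bar_boundaries H n) (bar_map H f)"

lemma bar_boundary_2:
  assumes "\<one>\<^bsub>G\<^esub> \<notin> {x, y}"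
  shows "bar_boundary G 2 (bar_symbol G [x, y]) =
    bar_symbol G [y] - bar_symbol G [x \<otimes>\<^bsub>G\<^esub> y] + bar_symbol G [x]"
  using assms
  by (simp add: bar_boundary_def bar_symbol_def bar_face_def numeral_2_eq_2)

lemma bar_boundary_3:
  assumes "\<one>\<^bsub>G\<^esub> \<notin> {x, y, z}"
  shows "bar_boundary G 3 (bar_symbol G [x, y, z]) =
    bar_symbol G [y, z] - bar_symbol G [x \<otimes>\<^bsub>G\<^esub> y, z] + bar_symbol G [x, y \<otimes>\<^bsub>G\<^esub> z] - bar_symbol G [x, y]"
  using assms
  by (simp add: bar_boundary_def bar_symbol_def bar_face_def numeral_3_eq_3)


section \<open>The Bogomolov multiplier\<close>

abbreviation schur_mult :: "('a, 'i) monoid_scheme \<Rightarrow> 'a bar_chain set monoid"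
  where "schur_mult G \<equiv> group_homology 2 G"

definition torus_class :: "('a, 'i) monoid_scheme \<Rightarrow> 'a \<Rightarrow> 'a \<Rightarrow> 'a bar_chain set"
  where "torus_class G x y =
    bar_boundaries G 2 #>\<^bsub>bar_cycle_group G 2\<^esub> (bar_symbol G [x, y] - bar_symbol G [y, x])"

definition torus_subgroup :: "('a, 'i) monoid_scheme \<Rightarrow> 'a bar_chain set set"
  where "torus_subgroup G = generate (schur_mult G)
    {torus_class G x y | x y. x \<in> carrier G \<and> y \<in> carrier G \<and> x \<otimes>\<^bsub>G\<^esub> y = y \<otimes>\<^bsub>G\<^esub> x}"

definition bogomolov_mult :: "('a, 'i) monoid_scheme \<Rightarrow> 'a bar_chain set set monoid"
  where "bogomolov_mult G = schur_mult G Mod torus_subgroup G"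

definition bogomolov_map ::
  "('b, 'j) monoid_scheme \<Rightarrow> ('a \<Rightarrow> 'b) \<Rightarrow> 'a bar_chain set set \<Rightarrow> 'b bar_chain set set"
  where "bogomolov_map H f =
    quot_induced (schur_mult H) (torus_subgroup H) (group_homology_map 2 H f)"


section \<open>The relative terms of a split extension\<close>

text \<open>The kernel of \<open>H\<^sub>2(p)\<close> for a projection \<open>p\<close> from \<open>G\<close> onto \<open>Q\<close>; it depends on the normal
  subgroup only through \<open>p\<close>.\<close>

definition rel_kernel :: "('a, 'i) monoid_scheme \<Rightarrow> ('b, 'j) monoid_scheme \<Rightarrow> ('a \<Rightarrow> 'b) \<Rightarrow> 'a bar_chain set set"
  where "rel_kernel G Q p = kernel (schur_mult G) (schur_mult Q) (group_homology_map 2 Q p)"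

text \<open>Homology groups are written multiplicatively, as all groups in this library.\<close>

definition delta_class ::
  "('a, 'i) monoid_scheme \<Rightarrow> ('b, 'j) monoid_scheme \<Rightarrow> ('a \<Rightarrow> 'b) \<Rightarrow> ('b \<Rightarrow> 'a) \<Rightarrow> 'a \<Rightarrow> 'a \<Rightarrow> 'a bar_chain set"
  where "delta_class G Q p s x y =
    torus_class G x y \<otimes>\<^bsub>schur_mult G\<^esub>
      inv\<^bsub>schur_mult G\<^esub> (group_homology_map 2 G s (torus_class Q (p x) (p y)))"

definition delta_subgroup ::
  "('a, 'i) monoid_scheme \<Rightarrow> ('b, 'j) monoid_scheme \<Rightarrow> ('a \<Rightarrow> 'b) \<Rightarrow> ('b \<Rightarrow> 'a) \<Rightarrow> 'a bar_chain set set"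
  where "delta_subgroup G Q p s = generate (schur_mult G)
    {delta_class G Q p s x y | x y. x \<in> carrier G \<and> y \<in> carrier G \<and> x \<otimes>\<^bsub>G\<^esub> y = y \<otimes>\<^bsub>G\<^esub> x}"

definition rel_quotient ::
  "('a, 'i) monoid_scheme \<Rightarrow> ('b, 'j) monoid_scheme \<Rightarrow> ('a \<Rightarrow> 'b) \<Rightarrow> ('b \<Rightarrow> 'a) \<Rightarrow> 'a bar_chain set set monoid"
  where "rel_quotient G Q p s =
    subgroup_generated (schur_mult G) (rel_kernel G Q p) Mod delta_subgroup G Q p s"

text \<open>The map from \<open>rel_quotient\<close> to the Bogomolov multiplier of \<open>G\<close> induced by the inclusion of
  \<open>rel_kernel\<close> into \<open>H\<^sub>2(G)\<close>.\<close>

definition rel_quotient_map :: "('a, 'i) monoid_scheme \<Rightarrow> 'a bar_chain set set \<Rightarrow> 'a bar_chain set set"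
  where "rel_quotient_map G = quot_induced (schur_mult G) (torus_subgroup G) (\<lambda>c. c)"

end

theory Submission
  imports Defs
begin

section \<open>Induced maps on quotients and split sequences of abelian groups\<close>

text \<open>Replacing \<open>a\<close> by another representative \<open>l \<otimes> a\<close>
  multiplies its image by \<open>f l\<close>, which lies in \<open>M\<close> and is absorbed by the
  coset. All members of the union defining \<open>quot_induced\<close> therefore agree.\<close>

lemma quot_induced_r_coset:
  assumes "group_hom A B f" "subgroup L A" "subgroup M B" "f ` L \<subseteq> M" "a \<in> carrier A"
  shows "quot_induced B M f (L #>\<^bsub>A\<^esub> a) = M #>\<^bsub>B\<^esub> f a"
proof -
  interpret group_hom A B f by fact
  have "M #>\<^bsub>B\<^esub> f (l \<otimes>\<^bsub>A\<^esub> a) = M #>\<^bsub>B\<^esub> f a" if "l \<in> L" for l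
  proof -
    have l: "l \<in> carrier A" "f l \<in> M"
      using that assms subgroup.mem_carrier by fastforce+
    then have "M #>\<^bsub>B\<^esub> f (l \<otimes>\<^bsub>A\<^esub> a) = M #>\<^bsub>B\<^esub> f l #>\<^bsub>B\<^esub> f a"
      using assms by (simp add: H.coset_mult_assoc subgroup.subset)
    then show ?thesis
      using l assms by (simp add: H.coset_join2)
  qed
  \<comment> \<open>The union collapses to the common coset only because it is taken over a nonempty
    set; the unit of \<open>L\<close> supplies a member.\<close>
  moreover have "\<one>\<^bsub>A\<^esub> \<in> L"
    using assms by (simp add: subgroup.one_closed)
  ultimately show ?thesis
    unfolding quot_induced_def r_coset_def[of A] by auto
qed

text \<open>Normality on both sides turns a product of cosets into the coset of the product, so
  multiplicativity of \<open>f\<close> on representatives passes to the quotients.\<close>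

lemma quot_induced_hom:
  assumes "group_hom A B f" "L \<lhd> A" "M \<lhd> B" "f ` L \<subseteq> M"
  shows "quot_induced B M f \<in> hom (A Mod L) (B Mod M)"
proof -
  interpret group_hom A B f by fact
  interpret L: normal L A by fact
  interpret M: normal M B by fact
  note coset = quot_induced_r_coset[OF assms(1) L.subgroup_axioms M.subgroup_axioms assms(4)]
  show ?thesis
    by (auto simp: hom_def carrier_FactGroup coset L.rcos_sum M.rcos_sum)
qed

text \<open>The map \<open>x \<mapsto> x \<cdot> t (p x)\<^sup>-\<^sup>1\<close> is an endomorphism of \<open>A\<close> that takes values in the kernel of \<open>p\<close>,
  fixes that kernel pointwise and preserves \<open>generate A S\<close>. Hence the image of \<open>generate A S\<close> is
  the intersection of \<open>generate A S\<close> with the kernel.\<close>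

lemma split_short_exact_quotients:
  assumes "comm_group A" "comm_group B" and p: "p \<in> hom A B" and t: "t \<in> hom B A"
    and pt: "\<And>b. b \<in> carrier B \<Longrightarrow> p (t b) = b"
    and S: "S \<subseteq> carrier A" and T: "T \<subseteq> carrier B" and pS: "p ` S \<subseteq> T" and tT: "t ` T \<subseteq> S"
  shows "split_short_exact
    (subgroup_generated A (kernel A B p) Mod generate A ((\<lambda>x. x \<otimes>\<^bsub>A\<^esub> inv\<^bsub>A\<^esub> t (p x)) ` S))
    (quot_induced A (generate A S) (\<lambda>c. c))
    (A Mod generate A S) (quot_induced B (generate B T) p)
    (B Mod generate B T) (quot_induced A (generate A S) t)"
proof -
  interpret A: comm_group A by fact
  interpret B: comm_group B by fact
  interpret p: group_hom A B p by unfold_locales (rule p)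
  interpret t: group_hom B A t by unfold_locales (rule t)
  define r where "r = (\<lambda>x. x \<otimes>\<^bsub>A\<^esub> inv\<^bsub>A\<^esub> t (p x))"
  define K A\<^sub>0 B\<^sub>0 D where "K = kernel A B p" and "A\<^sub>0 = generate A S" and "B\<^sub>0 = generate B T"
    and "D = generate A (r ` S)"
  \<comment> \<open>Commutativity of \<open>A\<close> enters here: the inverse factors have to be
    moved past the others for \<open>r\<close> to be multiplicative.\<close>
  have "r \<in> hom A A"
    by (auto simp: hom_def r_def A.inv_mult A.m_ac)
  then interpret r: group_hom A A r by unfold_locales
  interpret K: subgroup K A
    unfolding K_def by (rule p.subgroup_kernel)
  interpret A\<^sub>0: subgroup A\<^sub>0 A
    unfolding A\<^sub>0_def by (rule A.generate_is_subgroup[OF S])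
  interpret B\<^sub>0: subgroup B\<^sub>0 B
    unfolding B\<^sub>0_def by (rule B.generate_is_subgroup[OF T])
  have rA: "r ` S \<subseteq> carrier A" using S by auto
  interpret D: subgroup D A
    unfolding D_def by (rule A.generate_is_subgroup[OF rA])
  define AK where "AK = subgroup_generated A K"
  have AK[simp]: "carrier AK = K" "mult AK = mult A" "\<one>\<^bsub>AK\<^esub> = \<one>\<^bsub>A\<^esub>"
    unfolding AK_def by simp_all
  interpret AK: comm_group AK
    unfolding AK_def by (rule A.abelian_subgroup_generated[OF A.comm_group_axioms])
  \<comment> \<open>\<open>AK\<close> has the multiplication of \<open>A\<close>, so its cosets are
    the same sets as cosets in \<open>A\<close>; the two quotients can be compared without
    translation.\<close>
  have cosAK: "X #>\<^bsub>AK\<^esub> a = X #>\<^bsub>A\<^esub> a" for X a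
    by (simp add: r_coset_def)
  \<comment> \<open>A homomorphism maps a generated subgroup onto the subgroup generated by the
    image. The conditions on \<open>S\<close> and \<open>T\<close> thus extend from generators to
    \<open>A\<^sub>0\<close> and \<open>B\<^sub>0\<close>, which lets \<open>p\<close> and
    \<open>t\<close> descend.\<close>
  have pA\<^sub>0: "p ` A\<^sub>0 \<subseteq> B\<^sub>0"
    unfolding A\<^sub>0_def B\<^sub>0_def p.generate_img[OF S, symmetric] by (rule B.mono_generate[OF pS])
  have tB\<^sub>0: "t ` B\<^sub>0 \<subseteq> A\<^sub>0"
    unfolding A\<^sub>0_def B\<^sub>0_def t.generate_img[OF T, symmetric] by (rule A.mono_generate[OF tT])
  have rA\<^sub>0: "r ` A\<^sub>0 = D"
    unfolding A\<^sub>0_def D_def by (simp add: r.generate_img[OF S])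
  have rK: "r x = x" if "x \<in> K" for x
  proof -
    have "x \<in> carrier A" "p x = \<one>\<^bsub>B\<^esub>" using that unfolding K_def kernel_def by blast+
    then show ?thesis by (simp add: r_def)
  qed
  have r_in_K: "r x \<in> K" if "x \<in> carrier A" for x
  proof -
    have "p (r x) = \<one>\<^bsub>B\<^esub>" using that by (simp add: r_def pt)
    then show ?thesis using r.hom_closed[OF that] unfolding K_def kernel_def by blast
  qed
  have r_in_A\<^sub>0: "r x \<in> A\<^sub>0" if "x \<in> A\<^sub>0" for x
  proof -
    have "t (p x) \<in> A\<^sub>0" using that pA\<^sub>0 tB\<^sub>0 by blast
    with that show ?thesis by (simp add: r_def)
  qed
  \<comment> \<open>Both halves are used below: \<open>D \<subseteq> A\<^sub>0\<close> makes the
    inclusion of \<open>K\<close> descend to the quotients, and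
    \<open>K \<inter> A\<^sub>0 \<subseteq> D\<close> makes the descended map injective.\<close>
  have D_eq: "D = K \<inter> A\<^sub>0"
  proof (rule equalityI)
    show "D \<subseteq> K \<inter> A\<^sub>0"
      unfolding rA\<^sub>0[symmetric] using r_in_K[OF A\<^sub>0.mem_carrier] r_in_A\<^sub>0 by blast
    show "K \<inter> A\<^sub>0 \<subseteq> D"
      unfolding rA\<^sub>0[symmetric] by (metis IntE image_eqI rK subsetI)
  qed
  then have DK_sub: "D \<subseteq> K" and DA\<^sub>0_sub: "D \<subseteq> A\<^sub>0" by blast+
  have DK: "subgroup D AK"
    unfolding AK_def by (rule A.subgroup_of_subgroup_generated) (fact D.subgroup_axioms DK_sub)+
  have D_normal: "D \<lhd> AK" by (rule AK.subgroup_imp_normal[OF DK])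
  have A\<^sub>0_normal: "A\<^sub>0 \<lhd> A" by (rule A.subgroup_imp_normal[OF A\<^sub>0.subgroup_axioms])
  have B\<^sub>0_normal: "B\<^sub>0 \<lhd> B" by (rule B.subgroup_imp_normal[OF B\<^sub>0.subgroup_axioms])
  interpret i: group_hom AK A "\<lambda>c. c"
    by unfold_locales (auto simp: hom_def)
  have i_coset: "quot_induced A A\<^sub>0 (\<lambda>c. c) (D #>\<^bsub>A\<^esub> k) = A\<^sub>0 #>\<^bsub>A\<^esub> k" if "k \<in> K" for k
    using quot_induced_r_coset[OF i.group_hom_axioms DK A\<^sub>0.subgroup_axioms, of k] that DA\<^sub>0_sub
    by (simp add: cosAK)
  note p_coset = quot_induced_r_coset[OF p.group_hom_axioms A\<^sub>0.subgroup_axioms B\<^sub>0.subgroup_axioms pA\<^sub>0]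
  note t_coset = quot_induced_r_coset[OF t.group_hom_axioms B\<^sub>0.subgroup_axioms A\<^sub>0.subgroup_axioms tB\<^sub>0]
  let ?i = "quot_induced A A\<^sub>0 (\<lambda>c. c)" and ?p = "quot_induced B B\<^sub>0 p" and ?t = "quot_induced A A\<^sub>0 t"
  have i_hom: "?i \<in> hom (AK Mod D) (A Mod A\<^sub>0)"
    by (rule quot_induced_hom[OF i.group_hom_axioms D_normal A\<^sub>0_normal]) (use DA\<^sub>0_sub in simp)
  have groups: "group (AK Mod D)" "group (A Mod A\<^sub>0)" "group (B Mod B\<^sub>0)"
    using D_normal A\<^sub>0_normal B\<^sub>0_normal by (simp_all add: normal.factorgroup_is_group)
  have i_mon: "?i \<in> mon (AK Mod D) (A Mod A\<^sub>0)"
    unfolding mon_iff_hom_one[OF groups(1,2)]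
  proof (intro conjI allI impI i_hom)
    fix X assume "X \<in> carrier (AK Mod D) \<and> ?i X = \<one>\<^bsub>A Mod A\<^sub>0\<^esub>"
    then obtain k where k: "k \<in> K" "X = D #>\<^bsub>A\<^esub> k" "A\<^sub>0 #>\<^bsub>A\<^esub> k = A\<^sub>0"
      by (auto simp: carrier_FactGroup cosAK i_coset)
    then have "k \<in> A\<^sub>0"
      using A.coset_join1[OF _ _ A\<^sub>0.subgroup_axioms] K.mem_carrier by blast
    with k(1) have "k \<in> D" unfolding D_eq by blast
    then show "X = \<one>\<^bsub>AK Mod D\<^esub>"
      using k by (simp add: A.coset_join2[OF _ D.subgroup_axioms])
  qed
  have p_hom: "?p \<in> hom (A Mod A\<^sub>0) (B Mod B\<^sub>0)"
    by (rule quot_induced_hom[OF p.group_hom_axioms A\<^sub>0_normal B\<^sub>0_normal pA\<^sub>0])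
  have t_hom: "?t \<in> hom (B Mod B\<^sub>0) (A Mod A\<^sub>0)"
    by (rule quot_induced_hom[OF t.group_hom_axioms B\<^sub>0_normal A\<^sub>0_normal tB\<^sub>0])
  have pt_id: "?p (?t X) = X" if "X \<in> carrier (B Mod B\<^sub>0)" for X
    using that by (auto simp: carrier_FactGroup t_coset p_coset pt)
  \<comment> \<open>Surjectivity comes from the section: every coset \<open>X\<close> is the image
    of \<open>?t X\<close>.\<close>
  have p_epi: "?p \<in> epi (A Mod A\<^sub>0) (B Mod B\<^sub>0)"
    using p_hom hom_carrier[OF p_hom] hom_carrier[OF t_hom] pt_id by (force simp: epi_def)
  have "?i ` carrier (AK Mod D) = kernel (A Mod A\<^sub>0) (B Mod B\<^sub>0) ?p"
  proof (intro equalityI subsetI)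
    fix Y assume "Y \<in> ?i ` carrier (AK Mod D)"
    then obtain k where k: "k \<in> K" "Y = A\<^sub>0 #>\<^bsub>A\<^esub> k"
      by (auto simp: carrier_FactGroup cosAK i_coset)
    have "p k = \<one>\<^bsub>B\<^esub>"
      using k(1) unfolding K_def kernel_def by blast
    then have "?p Y = B\<^sub>0"
      using k by (simp add: p_coset B.coset_mult_one[OF B\<^sub>0.subset])
    moreover have "Y \<in> carrier (A Mod A\<^sub>0)"
      using k by (simp add: carrier_FactGroup)
    ultimately show "Y \<in> kernel (A Mod A\<^sub>0) (B Mod B\<^sub>0) ?p"
      by (simp add: kernel_def)
  next
    fix Y assume "Y \<in> kernel (A Mod A\<^sub>0) (B Mod B\<^sub>0) ?p"
    then obtain a where a: "a \<in> carrier A" "Y = A\<^sub>0 #>\<^bsub>A\<^esub> a" "B\<^sub>0 #>\<^bsub>B\<^esub> p a = B\<^sub>0"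
      by (auto simp: kernel_def carrier_FactGroup p_coset)
    then have "p a \<in> B\<^sub>0"
      by (intro B.coset_join1[OF _ p.hom_closed B\<^sub>0.subgroup_axioms])
    with tB\<^sub>0 have "t (p a) \<in> A\<^sub>0" by (rule subsetD[OF _ imageI])
    then have "inv\<^bsub>A\<^esub> t (p a) \<in> A\<^sub>0" by simp
    \<comment> \<open>A representative \<open>a\<close> of a class killed by \<open>?p\<close> need
      not lie in \<open>K\<close>. Its correction \<open>r a\<close> does, and it differs from
      \<open>a\<close> only by the factor \<open>inv t (p a)\<close> in \<open>A\<^sub>0\<close>, so
      it represents the same class.\<close>
    then have "A\<^sub>0 #>\<^bsub>A\<^esub> r a = Y"
      using a by (simp add: r_def A.m_comm[of a] A.coset_join2[OF _ A\<^sub>0.subgroup_axioms]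
          flip: A.coset_mult_assoc[OF A\<^sub>0.subset])
    then have "?i (D #>\<^bsub>AK\<^esub> r a) = Y"
      using r_in_K[OF a(1)] by (simp add: cosAK i_coset)
    moreover have "D #>\<^bsub>AK\<^esub> r a \<in> carrier (AK Mod D)"
      using r_in_K[OF a(1)] by (simp add: carrier_FactGroup)
    ultimately show "Y \<in> ?i ` carrier (AK Mod D)" by blast
  qed
  then have "split_short_exact (AK Mod D) ?i (A Mod A\<^sub>0) ?p (B Mod B\<^sub>0) ?t"
    unfolding split_short_exact_def short_exact_def
    using groups i_mon p_epi t_hom pt_id by simp
  then show ?thesis
    by (simp only: AK_def K_def D_def A\<^sub>0_def B\<^sub>0_def r_def)
qed

section \<open>Bar chains and the maps between them\<close>

lemma bar_boundary_diff: "bar_boundary G n (c - d) = bar_boundary G n c - bar_boundary G n d"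
  by (simp add: bar_boundary_def frag_extend_diff)

lemma bar_boundary_add: "bar_boundary G n (c + d) = bar_boundary G n c + bar_boundary G n d"
  by (simp add: bar_boundary_def frag_extend_add)

lemma bar_boundary_zero [simp]: "bar_boundary G n 0 = 0"
  by (simp add: bar_boundary_def)

lemma bar_map_diff: "bar_map H f (c - d) = bar_map H f c - bar_map H f d"
  by (simp add: bar_map_def frag_extend_diff)

lemma bar_map_add: "bar_map H f (c + d) = bar_map H f c + bar_map H f d"
  by (simp add: bar_map_def frag_extend_add)

lemma bar_map_zero [simp]: "bar_map H f 0 = 0"
  by (simp add: bar_map_def)

lemma mult_bar_chain_group [simp]: "c \<otimes>\<^bsub>bar_chain_group G n\<^esub> d = c + d"
  by (simp add: bar_chain_group_def)

lemma one_bar_chain_group [simp]: "\<one>\<^bsub>bar_chain_group G n\<^esub> = 0"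
  by (simp add: bar_chain_group_def)

lemma comm_group_bar_chain_group: "comm_group (bar_chain_group G n)"
  by (simp add: bar_chain_group_def abelian_free_Abelian_group)

lemma bar_chain_group_zero [simp]: "0 \<in> carrier (bar_chain_group G n)"
  by (simp add: bar_chain_group_def)

lemma bar_chain_group_add:
  "\<lbrakk>c \<in> carrier (bar_chain_group G n); d \<in> carrier (bar_chain_group G n)\<rbrakk>
    \<Longrightarrow> c + d \<in> carrier (bar_chain_group G n)"
  unfolding bar_chain_group_def by (metis
      group.is_monoid group_free_Abelian_group monoid.m_closed mult_free_Abelian_group)

lemma bar_chain_group_diff:
  "\<lbrakk>c \<in> carrier (bar_chain_group G n); d \<in> carrier (bar_chain_group G n)\<rbrakk>
    \<Longrightarrow> c - d \<in> carrier (bar_chain_group G n)"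
  unfolding bar_chain_group_def carrier_free_Abelian_group_iff
  by (rule order_trans[OF keys_diff Un_least])

lemma bar_symbol_in_bar_chain_group:
  assumes "length xs = n" "set xs \<subseteq> carrier G"
  shows "bar_symbol G xs \<in> carrier (bar_chain_group G n)"
  using assms by (auto simp: bar_symbol_def bar_chain_group_def)

text \<open>Chains are integer combinations of symbols, and differences starting from
  \<open>0\<close> yield sums and negatives alike. Statements compatible with subtraction can thus
  be checked on symbols alone.\<close>

lemma bar_chain_induct [consumes 1, case_names zero diff symbol]:
  assumes "c \<in> carrier (bar_chain_group G n)" "P 0"
    "\<And>c d. \<lbrakk>c \<in> carrier (bar_chain_group G n); d \<in> carrier (bar_chain_group G n); P c; P d\<rbrakk> \<Longrightarrow> P (c - d)"
    "\<And>xs. \<lbrakk>length xs = n; set xs \<subseteq> carrier G; \<one>\<^bsub>G\<^esub> \<notin> set xs\<rbrakk> \<Longrightarrow> P (bar_symbol G xs)"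
  shows "P c"
proof -
  let ?B = "{xs. length xs = n \<and> set xs \<subseteq> carrier G - {\<one>\<^bsub>G\<^esub>}}"
  have "Poly_Mapping.keys c \<subseteq> ?B"
    using assms(1) by (simp add: bar_chain_group_def)
  then show ?thesis
  proof (rule free_Abelian_group_induct[where P = P])
    fix xs assume "xs \<in> ?B"
    then have "\<one>\<^bsub>G\<^esub> \<notin> set xs" "length xs = n" "set xs \<subseteq> carrier G" by auto
    with assms(4)[of xs] show "P (frag_of xs)" by (simp add: bar_symbol_def)
  qed (use assms in \<open>auto simp: bar_chain_group_def\<close>)
qed

text \<open>A homomorphism preserves the unit, so a degenerate symbol has a degenerate image and
  both sides are \<open>0\<close>. A nondegenerate symbol may become degenerate;
  \<open>bar_symbol H\<close> then sends it to \<open>0\<close> on both sides.\<close>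

lemma bar_map_symbol:
  assumes "group_hom G H f"
  shows "bar_map H f (bar_symbol G xs) = bar_symbol H (map f xs)"
proof (cases "\<one>\<^bsub>G\<^esub> \<in> set xs")
  case True
  then have "\<one>\<^bsub>H\<^esub> \<in> set (map f xs)" using group_hom.hom_one[OF assms] by force
  with True show ?thesis by (simp add: bar_symbol_def bar_map_def)
qed (simp add: bar_symbol_def bar_map_def)

lemma bar_map_closed:
  assumes "group_hom G H f" "c \<in> carrier (bar_chain_group G n)"
  shows "bar_map H f c \<in> carrier (bar_chain_group H n)"
proof -
  interpret group_hom G H f by fact
  show ?thesis
    using assms(2)
  proof (induction rule: bar_chain_induct)
    case (symbol xs)
    then show ?case
      by (metis bar_map_symbol[OF group_hom_axioms] bar_symbol_in_bar_chain_group hom_closed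
          image_subsetI length_map list.set_map subsetD)
  qed (auto simp: bar_map_diff bar_chain_group_diff)
qed

lemma bar_map_inverse:
  assumes "group_hom G H f" "group_hom H G g" "\<And>x. x \<in> carrier G \<Longrightarrow> g (f x) = x"
    "c \<in> carrier (bar_chain_group G n)"
  shows "bar_map G g (bar_map H f c) = c"
  using assms(4)
proof (induction rule: bar_chain_induct)
  case (symbol xs)
  have "map (g \<circ> f) xs = xs"
    using symbol assms(3) by (auto intro!: map_idI)
  then show ?case
    by (simp add: bar_map_symbol[OF assms(1)] bar_map_symbol[OF assms(2)])
qed (auto simp: bar_map_diff)

lemma comm_group_bar_cycle_group: "comm_group (bar_cycle_group G n)"
proof -
  interpret comm_group "bar_chain_group G n" by (rule comm_group_bar_chain_group)
  show ?thesis
    unfolding bar_cycle_group_def by (rule abelian_subgroup_generated[OF comm_group_axioms])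
qed

lemma mult_bar_cycle_group [simp]: "c \<otimes>\<^bsub>bar_cycle_group G n\<^esub> d = c + d"
  by (simp add: bar_cycle_group_def)

section \<open>Cycles, boundaries and torus classes in degree two\<close>

context group
begin

text \<open>The formula survives degeneracy: if an entry is the unit, two terms on the right cancel
  and the third is degenerate. Later computations then need no case split on units.\<close>

lemma bar_boundary_2_symbol:
  assumes "x \<in> carrier G" "y \<in> carrier G"
  shows "bar_boundary G 2 (bar_symbol G [x, y]) =
    bar_symbol G [y] - bar_symbol G [x \<otimes> y] + bar_symbol G [x]"
proof -
  consider "x = \<one>" | "y = \<one>" | "\<one> \<notin> {x, y}" by blast
  then show ?thesis
  proof cases
    assume "\<one> \<notin> {x, y}"
    then show ?thesis by (rule bar_boundary_2)
  qed (use assms in \<open>simp_all add: bar_symbol_def\<close>)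
qed

text \<open>As in degree two, a unit entry makes two terms on the right cancel and the other two
  vanish as degenerate symbols.\<close>

lemma bar_boundary_3_symbol:
  assumes "x \<in> carrier G" "y \<in> carrier G" "z \<in> carrier G"
  shows "bar_boundary G 3 (bar_symbol G [x, y, z]) =
    bar_symbol G [y, z] - bar_symbol G [x \<otimes> y, z] + bar_symbol G [x, y \<otimes> z] - bar_symbol G [x, y]"
proof -
  consider "x = \<one>" | "y = \<one>" | "z = \<one>" | "\<one> \<notin> {x, y, z}" by blast
  then show ?thesis
  proof cases
    assume "\<one> \<notin> {x, y, z}"
    then show ?thesis by (rule bar_boundary_3)
  qed (use assms in \<open>simp_all add: bar_symbol_def\<close>)
qed

lemma bar_chain_2_induct [consumes 1, case_names zero diff symbol]:
  assumes "c \<in> carrier (bar_chain_group G 2)" "P 0"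
    "\<And>c d. \<lbrakk>c \<in> carrier (bar_chain_group G 2); d \<in> carrier (bar_chain_group G 2); P c; P d\<rbrakk> \<Longrightarrow> P (c - d)"
    "\<And>x y. \<lbrakk>x \<in> carrier G; y \<in> carrier G\<rbrakk> \<Longrightarrow> P (bar_symbol G [x, y])"
  shows "P c"
  using assms(1)
proof (induction rule: bar_chain_induct)
  case (symbol xs)
  then obtain x y where "xs = [x, y]"
    by (auto simp: numeral_2_eq_2 length_Suc_conv)
  with symbol assms(4) show ?case by simp
qed (use assms in auto)

lemma bar_chain_3_induct [consumes 1, case_names zero diff symbol]:
  assumes "c \<in> carrier (bar_chain_group G 3)" "P 0"
    "\<And>c d. \<lbrakk>c \<in> carrier (bar_chain_group G 3); d \<in> carrier (bar_chain_group G 3); P c; P d\<rbrakk> \<Longrightarrow> P (c - d)"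
    "\<And>x y z. \<lbrakk>x \<in> carrier G; y \<in> carrier G; z \<in> carrier G\<rbrakk> \<Longrightarrow> P (bar_symbol G [x, y, z])"
  shows "P c"
  using assms(1)
proof (induction rule: bar_chain_induct)
  case (symbol xs)
  then obtain x y z where "xs = [x, y, z]"
    by (auto simp: numeral_3_eq_3 length_Suc_conv)
  with symbol assms(4) show ?case by simp
qed (use assms in auto)

lemma bar_boundary_2_closed:
  "c \<in> carrier (bar_chain_group G 2) \<Longrightarrow> bar_boundary G 2 c \<in> carrier (bar_chain_group G 1)"
proof (induction rule: bar_chain_2_induct)
  case (symbol x y)
  then show ?case
    by (auto simp: bar_boundary_2_symbol
        intro!: bar_chain_group_add bar_chain_group_diff bar_symbol_in_bar_chain_group)
qed (auto simp: bar_boundary_diff bar_chain_group_diff)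

lemma bar_boundary_3_closed:
  "c \<in> carrier (bar_chain_group G 3) \<Longrightarrow> bar_boundary G 3 c \<in> carrier (bar_chain_group G 2)"
proof (induction rule: bar_chain_3_induct)
  case (symbol x y z)
  then show ?case
    by (auto simp: bar_boundary_3_symbol
        intro!: bar_chain_group_add bar_chain_group_diff bar_symbol_in_bar_chain_group)
qed (auto simp: bar_boundary_diff bar_chain_group_diff)

text \<open>The twelve terms arising from a symbol cancel in pairs; associativity identifies the two
  bracketings of the triple product.\<close>

lemma bar_boundary_2_3:
  "c \<in> carrier (bar_chain_group G 3) \<Longrightarrow> bar_boundary G 2 (bar_boundary G 3 c) = 0"
proof (induction rule: bar_chain_3_induct)
  case (symbol x y z)
  then show ?case
    by (simp add: bar_boundary_3_symbol bar_boundary_2_symbol bar_boundary_add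
        bar_boundary_diff m_assoc)
qed (auto simp: bar_boundary_diff)

text \<open>The cycle group is encoded as a generated subgroup. Since the kernel is already a
  subgroup, generation adds nothing, and the carrier is exactly the set of cycles.\<close>

lemma subgroup_bar_cycles_2:
  "subgroup (kernel (bar_chain_group G 2) (bar_chain_group G 1) (bar_boundary G 2)) (bar_chain_group G 2)"
proof -
  interpret C2: comm_group "bar_chain_group G 2" by (rule comm_group_bar_chain_group)
  interpret C1: comm_group "bar_chain_group G 1" by (rule comm_group_bar_chain_group)
  interpret group_hom "bar_chain_group G 2" "bar_chain_group G 1" "bar_boundary G 2"
    using bar_boundary_2_closed by unfold_locales (simp add: hom_def bar_boundary_add Pi_def)
  show ?thesis by (rule subgroup_kernel)
qed

lemma carrier_bar_cycle_group_2:
  "carrier (bar_cycle_group G 2) = {c \<in> carrier (bar_chain_group G 2). bar_boundary G 2 c = 0}"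
  unfolding bar_cycle_group_def
  using subgroup.carrier_subgroup_generated_subgroup[OF subgroup_bar_cycles_2]
  by (simp add: kernel_def)

lemma bar_boundaries_2:
  "bar_boundaries G 2 = bar_boundary G 3 ` carrier (bar_chain_group G 3)"
  by (simp add: bar_boundaries_def)

lemma subgroup_bar_boundaries_2: "subgroup (bar_boundaries G 2) (bar_cycle_group G 2)"
proof -
  interpret Z: comm_group "bar_cycle_group G 2" by (rule comm_group_bar_cycle_group)
  interpret C: comm_group "bar_chain_group G 3" by (rule comm_group_bar_chain_group)
  \<comment> \<open>The target is the group of cycles rather than of all chains, which is where the
    vanishing of the double boundary is used.\<close>
  interpret group_hom "bar_chain_group G 3" "bar_cycle_group G 2" "bar_boundary G 3"
    by unfold_locales (simp add: hom_def Pi_def carrier_bar_cycle_group_2 bar_boundary_3_closed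
        bar_boundary_2_3 bar_boundary_add)
  show ?thesis
    unfolding bar_boundaries_2 by (rule img_is_subgroup)
qed

lemma normal_bar_boundaries_2: "bar_boundaries G 2 \<lhd> bar_cycle_group G 2"
  using comm_group.subgroup_imp_normal[OF comm_group_bar_cycle_group subgroup_bar_boundaries_2] .

lemma comm_group_schur_mult: "comm_group (schur_mult G)"
  unfolding group_homology_def
  by (rule comm_group.abelian_FactGroup[OF comm_group_bar_cycle_group subgroup_bar_boundaries_2])

lemma carrier_schur_mult:
  "carrier (schur_mult G) =
    (\<lambda>c. bar_boundaries G 2 #>\<^bsub>bar_cycle_group G 2\<^esub> c) ` carrier (bar_cycle_group G 2)"
  by (simp add: group_homology_def carrier_FactGroup)

text \<open>The boundary reduces to \<open>[y \<otimes> x] - [x \<otimes> y]\<close>, which vanishes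
  because the elements commute.\<close>

lemma torus_cycle:
  assumes "x \<in> carrier G" "y \<in> carrier G" "x \<otimes> y = y \<otimes> x"
  shows "bar_symbol G [x, y] - bar_symbol G [y, x] \<in> carrier (bar_cycle_group G 2)"
  using assms
  by (simp add: carrier_bar_cycle_group_2 bar_boundary_diff bar_boundary_2_symbol
      bar_chain_group_diff bar_symbol_in_bar_chain_group)

lemma torus_class_closed:
  "\<lbrakk>x \<in> carrier G; y \<in> carrier G; x \<otimes> y = y \<otimes> x\<rbrakk> \<Longrightarrow> torus_class G x y \<in> carrier (schur_mult G)"
  unfolding carrier_schur_mult torus_class_def by (intro imageI torus_cycle)

end

section \<open>Functoriality of the second homology group\<close>

context group_hom
begin

text \<open>On symbols every face is either an entry or a product of entries, and a homomorphism
  respects both. With the analogue in degree three, this makes \<open>bar_map\<close> preserve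
  cycles and boundaries.\<close>

lemma bar_map_boundary_2:
  "c \<in> carrier (bar_chain_group G 2) \<Longrightarrow> bar_boundary H 2 (bar_map H h c) = bar_map H h (bar_boundary G 2 c)"
proof (induction rule: G.bar_chain_2_induct)
  case (symbol x y)
  then show ?case
    by (simp add: bar_map_symbol[OF group_hom_axioms] G.bar_boundary_2_symbol H.bar_boundary_2_symbol
        bar_map_add bar_map_diff)
qed (auto simp: bar_map_diff bar_boundary_diff)

lemma bar_map_boundary_3:
  "c \<in> carrier (bar_chain_group G 3) \<Longrightarrow> bar_boundary H 3 (bar_map H h c) = bar_map H h (bar_boundary G 3 c)"
proof (induction rule: G.bar_chain_3_induct)
  case (symbol x y z)
  then show ?case
    by (simp add: bar_map_symbol[OF group_hom_axioms] G.bar_boundary_3_symbol H.bar_boundary_3_symbol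
        bar_map_add bar_map_diff)
qed (auto simp: bar_map_diff bar_boundary_diff)

lemma bar_map_cycle_hom: "group_hom (bar_cycle_group G 2) (bar_cycle_group H 2) (bar_map H h)"
proof -
  interpret ZG: comm_group "bar_cycle_group G 2" by (rule comm_group_bar_cycle_group)
  interpret ZH: comm_group "bar_cycle_group H 2" by (rule comm_group_bar_cycle_group)
  show ?thesis
    by unfold_locales (simp add: hom_def Pi_def G.carrier_bar_cycle_group_2 H.carrier_bar_cycle_group_2
        bar_map_boundary_2 bar_map_closed[OF group_hom_axioms] bar_map_add)
qed

lemma bar_map_boundaries: "bar_map H h ` bar_boundaries G 2 \<subseteq> bar_boundaries H 2"
  unfolding G.bar_boundaries_2 H.bar_boundaries_2
  by (auto simp flip: bar_map_boundary_3 intro!: imageI bar_map_closed[OF group_hom_axioms])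

lemma group_homology_map_r_coset:
  assumes "c \<in> carrier (bar_cycle_group G 2)"
  shows "group_homology_map 2 H h (bar_boundaries G 2 #>\<^bsub>bar_cycle_group G 2\<^esub> c) =
    bar_boundaries H 2 #>\<^bsub>bar_cycle_group H 2\<^esub> bar_map H h c"
  unfolding group_homology_map_def
  by (rule quot_induced_r_coset[OF bar_map_cycle_hom G.subgroup_bar_boundaries_2
        H.subgroup_bar_boundaries_2 bar_map_boundaries assms])

lemma group_homology_map_hom: "group_homology_map 2 H h \<in> hom (schur_mult G) (schur_mult H)"
  unfolding group_homology_map_def group_homology_def
  by (rule quot_induced_hom[OF bar_map_cycle_hom G.normal_bar_boundaries_2
        H.normal_bar_boundaries_2 bar_map_boundaries])

lemma group_homology_map_torus_class:
  assumes "x \<in> carrier G" "y \<in> carrier G" "x \<otimes> y = y \<otimes> x"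
  shows "group_homology_map 2 H h (torus_class G x y) = torus_class H (h x) (h y)"
  unfolding torus_class_def
  by (simp add: group_homology_map_r_coset[OF G.torus_cycle[OF assms]] bar_map_diff
      bar_map_symbol[OF group_hom_axioms])

text \<open>Homomorphic images of commuting elements commute. Applied to the projection and to the
  section, this gives the two conditions on generating sets in
  \<open>split_short_exact_quotients\<close>.\<close>

lemma group_homology_map_torus_classes:
  "group_homology_map 2 H h `
      {torus_class G x y | x y. x \<in> carrier G \<and> y \<in> carrier G \<and> x \<otimes> y = y \<otimes> x}
    \<subseteq> {torus_class H x y | x y. x \<in> carrier H \<and> y \<in> carrier H \<and> x \<otimes>\<^bsub>H\<^esub> y = y \<otimes>\<^bsub>H\<^esub> x}"
proof (rule image_subsetI)
  fix u assume "u \<in> {torus_class G x y | x y. x \<in> carrier G \<and> y \<in> carrier G \<and> x \<otimes> y = y \<otimes> x}"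
  then obtain x y where xy: "x \<in> carrier G" "y \<in> carrier G" "x \<otimes> y = y \<otimes> x"
    and u: "u = torus_class G x y" by blast
  have hxy: "h x \<otimes>\<^bsub>H\<^esub> h y = h y \<otimes>\<^bsub>H\<^esub> h x"
    using xy hom_mult by metis
  show "group_homology_map 2 H h u \<in>
      {torus_class H x y | x y. x \<in> carrier H \<and> y \<in> carrier H \<and> x \<otimes>\<^bsub>H\<^esub> y = y \<otimes>\<^bsub>H\<^esub> x}"
    unfolding u group_homology_map_torus_class[OF xy]
    by (intro CollectI exI conjI) (rule refl hxy hom_closed xy)+
qed

end

text \<open>The identity holds already on representing cycles, by \<open>bar_map_inverse\<close>.
  With the section as \<open>f\<close> and the projection as \<open>g\<close>, the section of groups
  becomes a section on homology.\<close>

lemma group_homology_map_inverse: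
  assumes "group_hom G H f" "group_hom H G g" "\<And>x. x \<in> carrier G \<Longrightarrow> g (f x) = x"
    "u \<in> carrier (schur_mult G)"
  shows "group_homology_map 2 G g (group_homology_map 2 H f u) = u"
proof -
  interpret f: group_hom G H f by fact
  interpret g: group_hom H G g by fact
  obtain c where c: "c \<in> carrier (bar_cycle_group G 2)"
    and u: "u = bar_boundaries G 2 #>\<^bsub>bar_cycle_group G 2\<^esub> c"
    using assms(4) by (auto simp: f.G.carrier_schur_mult)
  have "bar_map H f c \<in> carrier (bar_cycle_group H 2)"
    using c group_hom.hom_closed[OF f.bar_map_cycle_hom] by blast
  moreover have "bar_map G g (bar_map H f c) = c"
    using c bar_map_inverse[OF assms(1-3), of c 2] by (simp add: f.G.carrier_bar_cycle_group_2)
  ultimately show ?thesis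
    using c by (simp add: u f.group_homology_map_r_coset g.group_homology_map_r_coset)
qed

section \<open>The split sequence of Bogomolov multipliers\<close>

theorem theorem6p4:
  fixes N :: "('n, 'i) monoid_scheme" and G :: "('g, 'j) monoid_scheme" and Q :: "('q, 'k) monoid_scheme"
    and \<iota> :: "'n \<Rightarrow> 'g" and \<pi> :: "'g \<Rightarrow> 'q" and s :: "'q \<Rightarrow> 'g"
  assumes "short_exact N \<iota> G \<pi> Q"
    and "s \<in> hom Q G"
    and "\<And>q. q \<in> carrier Q \<Longrightarrow> \<pi> (s q) = q"
  shows "split_short_exact
    (rel_quotient G Q \<pi> s) (rel_quotient_map G)
    (bogomolov_mult G) (bogomolov_map Q \<pi>)
    (bogomolov_mult Q) (bogomolov_map G s)"
proof -
  interpret p: group_hom G Q \<pi>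
    using assms(1) by (auto simp: short_exact_def epi_def group_hom_def group_hom_axioms_def)
  interpret s: group_hom Q G s
    using assms(2) by unfold_locales
  let ?S = "{torus_class G x y | x y. x \<in> carrier G \<and> y \<in> carrier G \<and> x \<otimes>\<^bsub>G\<^esub> y = y \<otimes>\<^bsub>G\<^esub> x}"
  let ?T = "{torus_class Q x y | x y. x \<in> carrier Q \<and> y \<in> carrier Q \<and> x \<otimes>\<^bsub>Q\<^esub> y = y \<otimes>\<^bsub>Q\<^esub> x}"
  let ?p = "group_homology_map 2 Q \<pi>" and ?t = "group_homology_map 2 G s"
  let ?r = "\<lambda>u. u \<otimes>\<^bsub>schur_mult G\<^esub> inv\<^bsub>schur_mult G\<^esub> ?t (?p u)"
  let ?D = "{delta_class G Q \<pi> s x y | x y. x \<in> carrier G \<and> y \<in> carrier G \<and> x \<otimes>\<^bsub>G\<^esub> y = y \<otimes>\<^bsub>G\<^esub> x}"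
  have S: "?S \<subseteq> carrier (schur_mult G)"
    using p.G.torus_class_closed by blast
  have T: "?T \<subseteq> carrier (schur_mult Q)"
    using p.H.torus_class_closed by blast
  have pt: "?p (?t u) = u" if "u \<in> carrier (schur_mult Q)" for u
    by (rule group_homology_map_inverse[OF s.group_hom_axioms p.group_hom_axioms assms(3) that])
  \<comment> \<open>Naturality of torus classes under \<open>\<pi>\<close> identifies the correcting
    term, so the generators of \<open>delta_subgroup\<close> are the images under \<open>?r\<close>
    of those of \<open>torus_subgroup\<close>.\<close>
  have r: "?r (torus_class G x y) = delta_class G Q \<pi> s x y"
    if "x \<in> carrier G" "y \<in> carrier G" "x \<otimes>\<^bsub>G\<^esub> y = y \<otimes>\<^bsub>G\<^esub> x" for x y
    unfolding delta_class_def p.group_homology_map_torus_class[OF that] ..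
  have "?r ` ?S = {?r (torus_class G x y) | x y.
      x \<in> carrier G \<and> y \<in> carrier G \<and> x \<otimes>\<^bsub>G\<^esub> y = y \<otimes>\<^bsub>G\<^esub> x}"
    by blast
  also have "\<dots> = ?D"
    by (intro Collect_cong iff_exI) (metis r)
  finally have D: "?r ` ?S = ?D" .
  \<comment> \<open>The abelian result is applied to the second homology groups of \<open>G\<close>
    and \<open>Q\<close>, with torus classes as generating sets; \<open>D\<close> then puts the
    denominator of the left term into the required form.\<close>
  note main = split_short_exact_quotients[OF p.G.comm_group_schur_mult p.H.comm_group_schur_mult
      p.group_homology_map_hom s.group_homology_map_hom pt S T
      p.group_homology_map_torus_classes s.group_homology_map_torus_classes]
  show ?thesis
    unfolding rel_quotient_def rel_quotient_map_def rel_kernel_def bogomolov_mult_def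
      bogomolov_map_def torus_subgroup_def delta_subgroup_def
    by (rule main[unfolded D])
qed

end
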